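(* Let $n,k\ge 0$ be integers. Suppose $P\subseteq Q_n$ is a convex subset of $Q_n$, ordered by the subset relation. Then $$w(P\times Q_k)\ge w(Q_{n+k})\,|P|\,2^{-n}.$$
   Context: For an integer $m\ge 0$, $Q_m$ denotes the power set of a set with $m$ elements, partially ordered by the subset relation $\subseteq$ (so $|Q_m|=2^m$). A subset $S$ of a poset $(X,\le)$ is called convex if whenever $u\le v\le w$ in $X$ with $u,w\in S$, also $v\in S$ (equivalently, $S$ is the intersection of an upset and a downset of $X$); the empty set is convex. A subset of a poset is regarded as a poset with the induced order. If $X$ and $Y$ are posets, $X\times Y$ is the set of ordered pairs $(x,y)$ with $x\in X$, $y\in Y$, ordered by $(x_1,y_1)\le (x_2,y_2)$ if and only if $x_1\le x_2$ and $y_1\le y_2$. An antichain in a poset is a subset of pairwise incomparable elements. The width $w(X)$ of a finite poset $X$ is the maximum size of an antichain in $X$ (so $w(\emptyset)=0$). *)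

theory Defs
  imports Complex_Main "HOL-Library.Product_Order"
begin

(* Posets are sets X :: 'a::order set with the order induced from the type. For pairs this
   is the componentwise order of HOL-Library.Product_Order, so the product of the posets
   X and Y is X \<times> Y. *)

definition Q :: "nat \<Rightarrow> nat set set" where
  "Q m = Pow {..<m}"

definition convex_subset :: "'a::order set \<Rightarrow> 'a set \<Rightarrow> bool" where
  "convex_subset S X \<longleftrightarrow>
     S \<subseteq> X \<and> (\<forall>u\<in>X. \<forall>v\<in>X. \<forall>w\<in>X. u \<le> v \<and> v \<le> w \<and> u \<in> S \<and> w \<in> S \<longrightarrow> v \<in> S)"

definition antichain :: "'a::order set \<Rightarrow> bool" where
  "antichain A \<longleftrightarrow> (\<forall>x\<in>A. \<forall>y\<in>A. x \<noteq> y \<longrightarrow> \<not> x \<le> y \<and> \<not> y \<le> x)"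

(* Meaningful for finite X only: Max is unspecified on infinite sets. *)
definition width :: "'a::order set \<Rightarrow> nat" where
  "width X = Max {card A | A. A \<subseteq> X \<and> antichain A}"

end

theory Submission
  imports Defs
begin

text \<open>
  Induction on \<open>n\<close>, for all \<open>k\<close> simultaneously. Splitting \<open>P\<close> along its last coordinate into slices
  \<open>P\<^sub>0\<close> and \<open>P\<^sub>1\<close>, it suffices that
  \<open>2 w(P \<times> Q\<^sub>k) \<ge> w(P\<^sub>0 \<times> Q\<^bsub>k+1\<^esub>) + w(P\<^sub>1 \<times> Q\<^bsub>k+1\<^esub>)\<close>.
  An antichain corresponds to a pair \<open>d' \<subseteq> d\<close> of downsets such that \<open>d'\<close> contains everything
  strictly below \<open>d\<close>; the antichain is \<open>d - d'\<close>. Such pairs are closed under componentwise union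
  and intersection, and the size of \<open>d - d'\<close> is modular. Given maximum antichains of
  \<open>P\<^sub>0 \<times> Q\<^bsub>k+1\<^esub>\<close> and \<open>P\<^sub>1 \<times> Q\<^bsub>k+1\<^esub>\<close>, with downsets \<open>u\<^sub>0, u\<^sub>1\<close> and \<open>v\<^sub>0, v\<^sub>1\<close> on the two layers of
  the new coordinate, the pairs \<open>(u\<^sub>0 \<union> v\<^sub>1, u\<^sub>1 \<inter> v\<^sub>0)\<close> and \<open>(u\<^sub>1 \<union> v\<^sub>0, u\<^sub>0 \<inter> v\<^sub>1)\<close> yield two antichains of
  \<open>P \<times> Q\<^sub>k\<close> of the same total size.
\<close>

section \<open>Antichains and width\<close>

lemma finite_antichain_sizes:
  assumes "finite X"
  shows "finite {card A | A. A \<subseteq> X \<and> antichain A}"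
  by (rule finite_subset[of _ "card ` Pow X"]) (use assms in auto)

lemma card_le_width:
  assumes "finite X" "A \<subseteq> X" "antichain A"
  shows "card A \<le> width X"
  unfolding width_def using assms by (intro Max_ge finite_antichain_sizes) auto

lemma width_attained:
  assumes "finite X"
  obtains A where "A \<subseteq> X" "antichain A" "card A = width X"
proof -
  have "antichain {}" by (simp add: antichain_def)
  then have "{card A | A. A \<subseteq> X \<and> antichain A} \<noteq> {}" by blast
  then have "width X \<in> {card A | A. A \<subseteq> X \<and> antichain A}"
    unfolding width_def by (rule Max_in[OF finite_antichain_sizes[OF assms]])
  then show ?thesis using that by auto
qed

section \<open>Layered antichains and the exchange\<close>

text \<open>\<open>A0\<close> on the lower and \<open>A1\<close> on the upper layer of a product with a two-element chain.\<close>
definition layered_antichain :: "'a::order set \<Rightarrow> 'a set \<Rightarrow> bool" where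
  "layered_antichain A0 A1 \<longleftrightarrow>
     antichain A0 \<and> antichain A1 \<and> (\<forall>x\<in>A0. \<forall>y\<in>A1. \<not> x \<le> y)"

lemma antichainI: "(\<And>x y. x \<in> A \<Longrightarrow> y \<in> A \<Longrightarrow> x \<le> y \<Longrightarrow> x = y) \<Longrightarrow> antichain A"
  unfolding antichain_def by blast

lemma antichainD: "antichain A \<Longrightarrow> x \<in> A \<Longrightarrow> y \<in> A \<Longrightarrow> x \<le> y \<Longrightarrow> x = y"
  unfolding antichain_def by blast

lemma antichain_iff_less: "antichain A \<longleftrightarrow> (\<forall>x\<in>A. \<forall>y\<in>A. \<not> x < y)"
  unfolding antichain_def by (auto simp: less_le)

text \<open>Cardinality is modular, so two pairs of sets can be compared point by point, counting
  multiplicity.\<close>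

lemma card_add_mono_Un_Int:
  assumes "finite C" "finite D" "A \<union> B \<subseteq> C \<union> D" "A \<inter> B \<subseteq> C \<inter> D"
  shows "card A + card B \<le> card C + card D"
proof -
  have "finite (A \<union> B)"
    by (rule finite_subset[OF assms(3)]) (simp add: assms(1,2))
  then have "finite A" "finite B" by simp_all
  then have "card A + card B = card (A \<union> B) + card (A \<inter> B)" by (rule card_Un_Int)
  also have "\<dots> \<le> card (C \<union> D) + card (C \<inter> D)"
    using assms by (intro add_mono card_mono) auto
  also have "\<dots> = card C + card D"
    using assms(1,2) by (rule card_Un_Int[symmetric])
  finally show ?thesis .
qed

text \<open>The layers change meaning: for \<open>A\<close> and \<open>B\<close> they are the two
  values of the new coordinate of \<open>Q (Suc k)\<close>, for the \<open>C\<close> and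
  \<open>D\<close> sets they are the two slices of \<open>P\<close>. Hypothesis \<open>conv\<close>
  is what convexity of \<open>P\<close> says across its slices.\<close>

lemma layered_antichain_exchange:
  fixes X0 X1 :: "'a::order set"
  assumes fin: "finite X0" "finite X1"
    and conv: "\<And>x y. x \<in> X0 \<Longrightarrow> y \<in> X1 \<Longrightarrow> x \<le> y \<Longrightarrow> x \<in> X1 \<and> y \<in> X0"
    and A: "A0 \<subseteq> X0" "A1 \<subseteq> X0" "layered_antichain A0 A1"
    and B: "B0 \<subseteq> X1" "B1 \<subseteq> X1" "layered_antichain B0 B1"
  obtains C0 C1 D0 D1 where
    "C0 \<subseteq> X0" "C1 \<subseteq> X1" "layered_antichain C0 C1"
    "D0 \<subseteq> X0" "D1 \<subseteq> X1" "layered_antichain D0 D1"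
    "card A0 + card A1 + card B0 + card B1 \<le> card C0 + card C1 + card D0 + card D1"
proof -
  text \<open>The \<open>u\<close> are the largest possible downsets for \<open>A\<close>, the \<open>v\<close> the smallest possible for \<open>B\<close>, so that
    by convexity \<open>X1 - X0\<close> lies in every \<open>u\<close> and \<open>X0 - X1\<close> meets no \<open>v\<close>.\<close>
  define u0 where "u0 = {x. \<forall>a\<in>A0. \<not> a < x}"
  define u0' where "u0' = {x. \<forall>a\<in>A0. \<not> a \<le> x}"
  \<comment> \<open>A point of the lower layer is strictly below its copy in the upper layer; hence
    the non-strict comparison with \<open>A0\<close> here and with \<open>B1\<close> in
    \<open>v0'\<close>.\<close>
  define u1 where "u1 = {x. (\<forall>a\<in>A0. \<not> a \<le> x) \<and> (\<forall>a\<in>A1. \<not> a < x)}"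
  define u1' where "u1' = {x. (\<forall>a\<in>A0. \<not> a \<le> x) \<and> (\<forall>a\<in>A1. \<not> a \<le> x)}"
  define v0 where "v0 = {x. (\<exists>b\<in>B0. x \<le> b) \<or> (\<exists>b\<in>B1. x \<le> b)}"
  define v0' where "v0' = {x. (\<exists>b\<in>B0. x < b) \<or> (\<exists>b\<in>B1. x \<le> b)}"
  define v1 where "v1 = {x. \<exists>b\<in>B1. x \<le> b}"
  define v1' where "v1' = {x. \<exists>b\<in>B1. x < b}"
  note defs = u0_def u0'_def u1_def u1'_def v0_def v0'_def v1_def v1'_def
  define C0 where "C0 = X0 \<inter> ((u0 \<union> v1) - (u0' \<union> v1'))"
  define C1 where "C1 = X1 \<inter> ((u1 \<inter> v0) - (u1' \<inter> v0'))"
  define D0 where "D0 = X0 \<inter> ((u1 \<union> v0) - (u1' \<union> v0'))"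
  define D1 where "D1 = X1 \<inter> ((u0 \<inter> v1) - (u0' \<inter> v1'))"
  note Cdefs = C0_def C1_def D0_def D1_def

  have strict: "x < y \<Longrightarrow> y \<in> u0 \<Longrightarrow> x \<in> u0'" "x < y \<Longrightarrow> y \<in> u1 \<Longrightarrow> x \<in> u1'"
    "x < y \<Longrightarrow> y \<in> v0 \<Longrightarrow> x \<in> v0'" "x < y \<Longrightarrow> y \<in> v1 \<Longrightarrow> x \<in> v1'" for x y
    unfolding defs mem_Collect_eq by (meson le_less_trans less_le_trans less_imp_le)+
  have cross: "x \<le> y \<Longrightarrow> y \<in> u1 \<Longrightarrow> x \<in> u0'" "x \<le> y \<Longrightarrow> y \<in> v1 \<Longrightarrow> x \<in> v0'" for x y
    unfolding defs mem_Collect_eq by (meson order_trans)+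
  \<comment> \<open>\<open>strict\<close> survives unions and intersections of the pairs, so each
    set is an antichain. Between layers, \<open>u1\<close> against \<open>u0'\<close> settles
    \<open>C0\<close>, \<open>C1\<close>, and \<open>v1\<close> against \<open>v0'\<close> settles
    \<open>D0\<close>, \<open>D1\<close>.\<close>
  have "layered_antichain C0 C1" "layered_antichain D0 D1"
    unfolding layered_antichain_def antichain_iff_less Cdefs using strict cross by blast+

  have A0: "x \<in> u0" "x \<notin> u0'" "x \<in> X0" if "x \<in> A0" for x
    using that A unfolding defs layered_antichain_def antichain_iff_less by auto
  have A1: "x \<in> u1" "x \<notin> u1'" "x \<in> X0" if "x \<in> A1" for x
    using that A unfolding defs layered_antichain_def antichain_iff_less by auto
  have B0: "x \<in> v0" "x \<notin> v0'" "x \<in> X1" if "x \<in> B0" for x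
    using that B unfolding defs layered_antichain_def antichain_iff_less by auto
  have B1: "x \<in> v1" "x \<notin> v1'" "x \<in> X1" if "x \<in> B1" for x
    using that B unfolding defs layered_antichain_def antichain_iff_less by auto
  have prime_sub: "u0' \<subseteq> u0" "u1' \<subseteq> u1" "v0' \<subseteq> v0" "v1' \<subseteq> v1"
    unfolding defs by (auto dest: less_imp_le)
  have v_X1: "x \<in> X1" if "x \<in> X0" "x \<in> v0 \<or> x \<in> v1" for x
    using that conv B unfolding defs by blast
  have u_X0: "x \<in> X0" if "x \<in> X1" "x \<notin> u0' \<or> x \<notin> u1'" for x
    using that conv A unfolding defs by blast

  \<comment> \<open>\<open>C0\<close> and \<open>D1\<close> are the union and the intersection built
    from the same pairs, \<open>u0\<close> and \<open>v1\<close>. On \<open>X0 \<inter> X1\<close>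
    modularity applies. On \<open>X0 - X1\<close> the \<open>v\<close> sets vanish and
    \<open>C0\<close> is \<open>A0\<close>; on \<open>X1 - X0\<close> the \<open>u\<close> sets are
    everything and \<open>D1\<close> is \<open>B1\<close>.\<close>
  have "card A0 + card B1 \<le> card C0 + card D1"
  proof (rule card_add_mono_Un_Int)
    show "finite C0" "finite D1" using fin by (simp_all add: Cdefs)
    show "A0 \<union> B1 \<subseteq> C0 \<union> D1" "A0 \<inter> B1 \<subseteq> C0 \<inter> D1"
      unfolding Cdefs using A0 B1 v_X1 u_X0 prime_sub by blast+
  qed
  moreover have "card A1 + card B0 \<le> card D0 + card C1"
  proof (rule card_add_mono_Un_Int)
    show "finite D0" "finite C1" using fin by (simp_all add: Cdefs)
    show "A1 \<union> B0 \<subseteq> D0 \<union> C1" "A1 \<inter> B0 \<subseteq> D0 \<inter> C1"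
      unfolding Cdefs using A1 B0 v_X1 u_X0 prime_sub by blast+
  qed
  ultimately show ?thesis
    using that[of C0 C1 D0 D1] \<open>layered_antichain C0 C1\<close> \<open>layered_antichain D0 D1\<close>
    by (auto simp: Cdefs)
qed

section \<open>Splitting off one coordinate\<close>

lemma finite_Q [simp]: "finite (Q m)"
  by (simp add: Q_def)

lemma notin_Q: "q \<in> Q k \<Longrightarrow> k \<notin> q"
  by (auto simp: Q_def)

text \<open>Elements of \<open>A\<close> are sorted by whether \<open>k\<close> lies in the second
  component; deleting it there puts both layers over \<open>X \<times> Q k\<close>.\<close>

lemma antichain_split:
  fixes X :: "'a::order set"
  assumes "finite X" "A \<subseteq> X \<times> Q (Suc k)" "antichain A"
  obtains A0 A1 where "A0 \<subseteq> X \<times> Q k" "A1 \<subseteq> X \<times> Q k" "layered_antichain A0 A1"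
    "card A = card A0 + card A1"
proof -
  define f :: "'a \<times> nat set \<Rightarrow> 'a \<times> nat set" where "f = (\<lambda>(p, q). (p, insert k q))"
  define A0 where "A0 = A \<inter> X \<times> Q k"
  define A1 where "A1 = {z \<in> X \<times> Q k. f z \<in> A}"
  \<comment> \<open>On sets without \<open>k\<close>, inserting \<open>k\<close> is an order
    embedding; injectivity (\<open>f_eq\<close>) follows by antisymmetry.\<close>
  have f_le: "f x \<le> f y \<longleftrightarrow> x \<le> y" if "x \<in> X \<times> Q k" "y \<in> X \<times> Q k" for x y
    using that by (auto simp: f_def less_eq_prod_def notin_Q subset_insert)
  have le_f: "x \<le> y \<Longrightarrow> x \<le> f y" for x y
    by (auto simp: f_def less_eq_prod_def split: prod.splits)
  have f_notin: "f z \<notin> X \<times> Q k" for z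
    by (auto simp: f_def Q_def split: prod.splits)
  have f_eq: "x = y" if "f x = f y" "x \<in> X \<times> Q k" "y \<in> X \<times> Q k" for x y
    using f_le[OF that(2,3)] f_le[OF that(3,2)] that(1) by (simp add: order.antisym)
  have "A \<subseteq> A0 \<union> f ` A1"
  proof
    fix z assume "z \<in> A"
    obtain p q where z: "z = (p, q)" by force
    with \<open>z \<in> A\<close> assms(2) have pq: "p \<in> X" "q \<subseteq> {..<Suc k}" by (auto simp: Q_def)
    show "z \<in> A0 \<union> f ` A1"
    proof (cases "k \<in> q")
      case True
      then have "z = f (p, q - {k})" using z by (auto simp: f_def)
      moreover have "(p, q - {k}) \<in> X \<times> Q k" using pq by (auto simp: Q_def less_Suc_eq)
      ultimately show ?thesis using \<open>z \<in> A\<close> by (auto simp: A1_def)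
    next
      case False
      then have "q \<subseteq> {..<k}" using pq(2) less_Suc_eq by blast
      then show ?thesis using pq z \<open>z \<in> A\<close> by (auto simp: A0_def Q_def)
    qed
  qed
  then have "A = A0 \<union> f ` A1" by (auto simp: A0_def A1_def)
  moreover have "f z \<notin> A0" for z using f_notin[of z] by (simp add: A0_def)
  then have "A0 \<inter> f ` A1 = {}" by (metis disjoint_iff imageE)
  moreover have "finite A0" "finite A1" using assms(1) by (auto simp: A0_def A1_def)
  moreover have "inj_on f A1" using f_eq by (auto simp: inj_on_def A1_def)
  ultimately have "card A = card A0 + card A1"
    by (metis card_Un_disjoint card_image finite_imageI)
  moreover have "antichain A0" using assms(3) by (auto simp: antichain_def A0_def)
  moreover have "antichain A1"
  proof (rule antichainI)
    fix x y assume "x \<in> A1" "y \<in> A1" "x \<le> y"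
    then have xy: "x \<in> X \<times> Q k" "y \<in> X \<times> Q k" "f x \<in> A" "f y \<in> A" "f x \<le> f y"
      using f_le by (auto simp: A1_def)
    show "x = y" using f_eq[OF antichainD[OF assms(3) xy(3-5)] xy(1,2)] .
  qed
  moreover have "\<not> x \<le> y" if "x \<in> A0" "y \<in> A1" for x y
  proof
    assume "x \<le> y"
    then have "x \<le> f y" by (rule le_f)
    moreover have "x \<noteq> f y" using f_notin[of y] that(1) unfolding A0_def by (metis IntD2)
    ultimately show False using that assms(3) by (auto simp: A0_def A1_def antichain_def)
  qed
  ultimately show ?thesis
    using that[of A0 A1] by (auto simp: A0_def A1_def layered_antichain_def)
qed

definition slice0 :: "nat \<Rightarrow> nat set set \<Rightarrow> nat set set" where
  "slice0 n P = {p \<in> Q n. p \<in> P}"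

definition slice1 :: "nat \<Rightarrow> nat set set \<Rightarrow> nat set set" where
  "slice1 n P = {p \<in> Q n. insert n p \<in> P}"

text \<open>A converse to \<open>antichain_split\<close>, now in the first factor: inserting
  \<open>n\<close> lifts the upper layer back into \<open>P\<close>, and no set containing
  \<open>n\<close> is below one without it.\<close>

lemma layered_antichain_join:
  fixes Y :: "'b::order set"
  assumes "finite Y" "C0 \<subseteq> slice0 n P \<times> Y" "C1 \<subseteq> slice1 n P \<times> Y" "layered_antichain C0 C1"
  obtains C where "C \<subseteq> P \<times> Y" "antichain C" "card C = card C0 + card C1"
proof -
  define f :: "nat set \<times> 'b \<Rightarrow> nat set \<times> 'b" where "f = (\<lambda>(p, q). (insert n p, q))"
  have f_le: "f x \<le> f y \<longleftrightarrow> x \<le> y" if "x \<in> Q n \<times> Y" "y \<in> Q n \<times> Y" for x y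
    using that by (auto simp: f_def less_eq_prod_def notin_Q subset_insert)
  have le_f: "x \<le> f y \<longleftrightarrow> x \<le> y" if "x \<in> Q n \<times> Y" for x y
    using that by (auto simp: f_def less_eq_prod_def notin_Q subset_insert split: prod.splits)
  have f_not_le: "\<not> f x \<le> y" if "y \<in> Q n \<times> Y" for x y
    using that by (auto simp: f_def less_eq_prod_def notin_Q subset_insert split: prod.splits)
  have sub: "C0 \<subseteq> Q n \<times> Y" "C1 \<subseteq> Q n \<times> Y"
    using assms(2,3) by (auto simp: slice0_def slice1_def)
  have fin: "finite C0" "finite C1"
    using sub assms(1) by (meson finite_Q finite_SigmaI finite_subset)+
  have f_eq: "x = y" if "f x = f y" "x \<in> C1" "y \<in> C1" for x y
    using f_le[of x y] f_le[of y x] that(1) subsetD[OF sub(2) that(2)] subsetD[OF sub(2) that(3)]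
    by (simp add: order.antisym)
  then have "inj_on f C1" by (rule inj_onI)
  moreover have "f x \<notin> C0" for x using f_not_le[of "f x" x] sub(1) by auto
  then have "C0 \<inter> f ` C1 = {}" by (metis disjoint_iff imageE)
  ultimately have "card (C0 \<union> f ` C1) = card C0 + card C1"
    using fin by (simp add: card_Un_disjoint card_image)
  moreover have "antichain (C0 \<union> f ` C1)"
  proof (rule antichainI, elim UnE imageE)
    fix x y assume "x \<in> C0" "y \<in> C0" "x \<le> y"
    then show "x = y" using assms(4) antichainD by (metis layered_antichain_def)
  next
    fix x y z assume "x \<in> C0" "z \<in> C1" "y = f z" "x \<le> y"
    then have False using assms(4) sub le_f[of x z] by (auto simp: layered_antichain_def)
    then show "x = y" ..
  next
    fix x y z assume "z \<in> C1" "x = f z" "y \<in> C0" "x \<le> y"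
    then have False using sub(1) f_not_le[of y z] by auto
    then show "x = y" ..
  next
    fix x y w z assume "w \<in> C1" "z \<in> C1" "x = f w" "y = f z" "x \<le> y"
    moreover from this have "w \<le> z" using sub(2) f_le[of w z] by auto
    ultimately show "x = y" using assms(4) antichainD by (metis layered_antichain_def)
  qed
  moreover have "C0 \<union> f ` C1 \<subseteq> P \<times> Y"
    using assms(2,3) by (auto simp: slice0_def slice1_def f_def)
  ultimately show ?thesis using that by blast
qed

lemma finite_convex_subset_Q: "convex_subset P (Q n) \<Longrightarrow> finite P"
  by (meson convex_subset_def finite_Q finite_subset)

text \<open>The third claim supplies \<open>conv\<close> in the exchange.\<close>

lemma convex_slices:
  assumes "convex_subset P (Q (Suc n))"
  shows "convex_subset (slice0 n P) (Q n)" "convex_subset (slice1 n P) (Q n)"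
    and "p \<in> slice0 n P \<Longrightarrow> q \<in> slice1 n P \<Longrightarrow> p \<le> q \<Longrightarrow> p \<in> slice1 n P \<and> q \<in> slice0 n P"
proof -
  have in_Q: "r \<in> Q (Suc n)" "insert n r \<in> Q (Suc n)" if "r \<in> Q n" for r
    using that by (auto simp: Q_def)
  have conv: "v \<in> P" if "u \<in> P" "w \<in> P" "v \<in> Q (Suc n)" "u \<subseteq> v" "v \<subseteq> w" for u v w
  proof -
    have "u \<in> Q (Suc n)" "w \<in> Q (Suc n)"
      using that(1,2) conjunct1[OF assms[unfolded convex_subset_def]] by auto
    then show ?thesis
      using assms[unfolded convex_subset_def, THEN conjunct2, rule_format, of u v w] that by simp
  qed
  show "convex_subset (slice0 n P) (Q n)" unfolding convex_subset_def
  proof (intro conjI ballI impI)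
    show "slice0 n P \<subseteq> Q n" by (auto simp: slice0_def)
    fix u v w assume "v \<in> Q n" "u \<subseteq> v \<and> v \<subseteq> w \<and> u \<in> slice0 n P \<and> w \<in> slice0 n P"
    then show "v \<in> slice0 n P" using conv[of u w v] in_Q(1) by (simp add: slice0_def)
  qed
  show "convex_subset (slice1 n P) (Q n)" unfolding convex_subset_def
  proof (intro conjI ballI impI)
    show "slice1 n P \<subseteq> Q n" by (auto simp: slice1_def)
    fix u v w assume v: "v \<in> Q n" and uw: "u \<subseteq> v \<and> v \<subseteq> w \<and> u \<in> slice1 n P \<and> w \<in> slice1 n P"
    then have "insert n u \<subseteq> insert n v" "insert n v \<subseteq> insert n w" by auto
    then show "v \<in> slice1 n P"
      using conv[of "insert n u" "insert n w" "insert n v"] in_Q(2)[OF v] v uw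
      by (simp add: slice1_def del: insert_subset)
  qed
  assume "p \<in> slice0 n P" "q \<in> slice1 n P" "p \<le> q"
  then have pq: "p \<in> Q n" "q \<in> Q n" "p \<in> P" "insert n q \<in> P" "p \<subseteq> q"
    by (simp_all add: slice0_def slice1_def)
  \<comment> \<open>Both \<open>insert n p\<close> and \<open>q\<close> lie between \<open>p\<close>
    and \<open>insert n q\<close>, which belong to \<open>P\<close>.\<close>
  then have "insert n p \<subseteq> insert n q" "p \<subseteq> insert n p" "p \<subseteq> q" "q \<subseteq> insert n q" by blast+
  then have "insert n p \<in> P" "q \<in> P"
    using conv[OF pq(3,4) in_Q(2)[OF pq(1)]] conv[OF pq(3,4) in_Q(1)[OF pq(2)]] by blast+
  then show "p \<in> slice1 n P \<and> q \<in> slice0 n P"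
    using pq by (simp add: slice0_def slice1_def)
qed

lemma card_slices:
  assumes "P \<subseteq> Q (Suc n)"
  shows "card P = card (slice0 n P) + card (slice1 n P)"
proof -
  have "P \<subseteq> slice0 n P \<union> insert n ` slice1 n P"
  proof
    fix p assume "p \<in> P"
    then have p: "p \<subseteq> {..<Suc n}" using assms by (auto simp: Q_def)
    show "p \<in> slice0 n P \<union> insert n ` slice1 n P"
    proof (cases "n \<in> p")
      case True
      then have p_eq: "insert n (p - {n}) = p" by (rule insert_Diff)
      have "p - {n} \<in> Q n" using p by (auto simp: Q_def less_Suc_eq)
      then have "p - {n} \<in> slice1 n P"
        using \<open>p \<in> P\<close> p_eq by (simp add: slice1_def)
      then show ?thesis using p_eq by (metis UnI2 imageI)
    next
      case False
      then have "p \<subseteq> {..<n}" using p less_Suc_eq by blast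
      then show ?thesis using \<open>p \<in> P\<close> by (auto simp: slice0_def Q_def)
    qed
  qed
  then have "P = slice0 n P \<union> insert n ` slice1 n P" by (auto simp: slice0_def slice1_def)
  moreover have "slice0 n P \<inter> insert n ` slice1 n P = {}" by (auto simp: slice0_def Q_def)
  moreover have "inj_on (insert n) (slice1 n P)"
  proof (rule inj_onI)
    fix p q assume "p \<in> slice1 n P" "q \<in> slice1 n P" "insert n p = insert n q"
    moreover from this have "n \<notin> p" "n \<notin> q" by (auto simp: slice1_def Q_def)
    ultimately show "p = q" by (simp add: insert_ident)
  qed
  moreover have "finite (slice0 n P)" "finite (slice1 n P)"
    by (auto simp: slice0_def slice1_def)
  ultimately show ?thesis by (metis card_Un_disjoint card_image finite_imageI)
qed

section \<open>The slice inequality and the induction\<close>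

lemma width_slices:
  assumes "convex_subset P (Q (Suc n))"
  shows "width (slice0 n P \<times> Q (Suc k)) + width (slice1 n P \<times> Q (Suc k)) \<le> 2 * width (P \<times> Q k)"
proof -
  have fin: "finite (slice0 n P)" "finite (slice1 n P)" "finite (P \<times> Q k)"
    using finite_convex_subset_Q[OF assms] by (auto simp: slice0_def slice1_def)
  obtain A where A: "A \<subseteq> slice0 n P \<times> Q (Suc k)" "antichain A"
    "card A = width (slice0 n P \<times> Q (Suc k))"
    using width_attained[OF finite_SigmaI[OF fin(1) finite_Q]] .
  obtain B where B: "B \<subseteq> slice1 n P \<times> Q (Suc k)" "antichain B"
    "card B = width (slice1 n P \<times> Q (Suc k))"
    using width_attained[OF finite_SigmaI[OF fin(2) finite_Q]] .
  obtain A0 A1 where A': "A0 \<subseteq> slice0 n P \<times> Q k" "A1 \<subseteq> slice0 n P \<times> Q k"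
    "layered_antichain A0 A1" "card A = card A0 + card A1"
    using antichain_split[OF fin(1) A(1,2)] .
  obtain B0 B1 where B': "B0 \<subseteq> slice1 n P \<times> Q k" "B1 \<subseteq> slice1 n P \<times> Q k"
    "layered_antichain B0 B1" "card B = card B0 + card B1"
    using antichain_split[OF fin(2) B(1,2)] .
  have conv: "x \<in> slice1 n P \<times> Q k \<and> y \<in> slice0 n P \<times> Q k"
    if "x \<in> slice0 n P \<times> Q k" "y \<in> slice1 n P \<times> Q k" "x \<le> y" for x y
    using that convex_slices(3)[OF assms, of "fst x" "fst y"]
    by (simp add: less_eq_prod_def mem_Times_iff)
  obtain C0 C1 D0 D1 where CD:
    "C0 \<subseteq> slice0 n P \<times> Q k" "C1 \<subseteq> slice1 n P \<times> Q k" "layered_antichain C0 C1"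
    "D0 \<subseteq> slice0 n P \<times> Q k" "D1 \<subseteq> slice1 n P \<times> Q k" "layered_antichain D0 D1"
    "card A0 + card A1 + card B0 + card B1 \<le> card C0 + card C1 + card D0 + card D1"
    using layered_antichain_exchange[OF finite_SigmaI[OF fin(1) finite_Q]
        finite_SigmaI[OF fin(2) finite_Q] conv A'(1-3) B'(1-3)] .
  obtain C where C: "C \<subseteq> P \<times> Q k" "antichain C" "card C = card C0 + card C1"
    using layered_antichain_join[OF finite_Q CD(1-3)] .
  obtain D where D: "D \<subseteq> P \<times> Q k" "antichain D" "card D = card D0 + card D1"
    using layered_antichain_join[OF finite_Q CD(4-6)] .
  show ?thesis
    using card_le_width[OF fin(3) C(1,2)] card_le_width[OF fin(3) D(1,2)] C(3) D(3) CD(7)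
      A(3) A'(4) B(3) B'(4) by linarith
qed

lemma width_singleton_Times:
  assumes "finite Y"
  shows "width Y \<le> width ({p::'a::order} \<times> Y)"
proof -
  obtain A where A: "A \<subseteq> Y" "antichain A" "card A = width Y"
    using width_attained[OF assms] .
  have "antichain (Pair p ` A)"
    using A(2) by (auto simp: antichain_def less_eq_prod_def)
  then have "card (Pair p ` A) \<le> width ({p} \<times> Y)"
    using assms A(1) by (intro card_le_width) auto
  then show ?thesis using A(3) by (simp add: card_image inj_on_def)
qed

text \<open>Division-free form of the theorem. Passing to slices trades \<open>Suc n\<close>,
  \<open>k\<close> for \<open>n\<close>, \<open>Suc k\<close>, so the factor
  \<open>width (Q (n + k))\<close> stays the same throughout the induction.\<close>

lemma width_Q_mult_card_le:
  assumes "convex_subset P (Q n)"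
  shows "width (Q (n + k)) * card P \<le> 2 ^ n * width (P \<times> Q k)"
  using assms
proof (induction n arbitrary: P k)
  case 0
  then have "P = {} \<or> P = {{}}" by (auto simp: convex_subset_def Q_def)
  then show ?case using width_singleton_Times[OF finite_Q, of k "{} :: nat set"] by auto
next
  case (Suc n)
  then have P: "P \<subseteq> Q (Suc n)" by (simp add: convex_subset_def)
  have "width (Q (Suc n + k)) * card P
      = width (Q (n + Suc k)) * card (slice0 n P) + width (Q (n + Suc k)) * card (slice1 n P)"
    by (simp add: card_slices[OF P] distrib_left)
  also from Suc.prems have "\<dots> \<le> 2 ^ n * width (slice0 n P \<times> Q (Suc k)) + 2 ^ n * width (slice1 n P \<times> Q (Suc k))"
    by (intro add_mono Suc.IH convex_slices(1,2))
  also have "\<dots> \<le> 2 ^ n * (2 * width (P \<times> Q k))"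
    using width_slices[OF Suc.prems] by (simp flip: distrib_left)
  finally show ?case by simp
qed

theorem theorem1:
  fixes n k :: nat and P :: "nat set set"
  assumes "convex_subset P (Q n)"
  shows "real (width (P \<times> Q k)) \<ge> real (width (Q (n + k))) * real (card P) / 2 ^ n"
proof -
  have "real (width (Q (n + k)) * card P) \<le> real (2 ^ n * width (P \<times> Q k))"
    using width_Q_mult_card_le[OF assms] by (simp only: of_nat_le_iff)
  then show ?thesis by (simp add: field_simps)
qed

end
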